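(* Let $T \subset \mathbb{R}^3$ be a tetrahedron. Then either $T$ is a height function, or at most one tetrahedral subdivision of $T$ is needed to produce two height function tetrahedra; that is, either $T$ is a height function, or there exists a tetrahedral subdivision $T = T_0 \cup T_1$ such that both $T_0$ and $T_1$ are height functions.
   Context: A tetrahedron is the convex hull $T=\operatorname{conv}\{v_0,v_1,v_2,v_3\}$ of four affinely independent points of $\mathbb{R}^3$. A polyhedron $P\subset\mathbb{R}^3$ is called a height function if there exists a (two-dimensional) face $F$ of $P$ such that the orthogonal projection $\pi_F:\mathbb{R}^3\to\operatorname{aff}(F)$ onto the affine plane containing $F$ satisfies $\pi_F(P)\subseteq F$; such an $F$ is called a foundation of $P$. A tetrahedral subdivision of a tetrahedron $T$ is a decomposition $T=T_0\cup T_1$ for which there is an affine plane $\Pi\subset\mathbb{R}^3$ with $T_0\cap T_1=T\cap\Pi$, where $T_0$ and $T_1$ are distinct (3-dimensional, non-degenerate) tetrahedra, one contained in each of the two closed half-spaces determined by $\Pi$. *)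

theory Defs
  imports "HOL-Analysis.Analysis"
begin

definition tetrahedron :: "(real ^ 3) set \<Rightarrow> bool" where
  "tetrahedron T \<longleftrightarrow> 3 simplex T"

text \<open>Well defined when \<open>A\<close> is a nonempty affine subspace, by the lemma that follows.\<close>

definition orthogonal_projection :: "'a::euclidean_space set \<Rightarrow> 'a \<Rightarrow> 'a" where
  "orthogonal_projection A x = (THE p. p \<in> A \<and> (\<forall>y\<in>A. orthogonal (x - p) (y - p)))"

lemma orthogonal_projection_ex1:
  fixes A :: "'a::euclidean_space set"
  assumes "affine A" "A \<noteq> {}"
  shows "\<exists>!p. p \<in> A \<and> (\<forall>y\<in>A. orthogonal (x - p) (y - p))"
proof (rule ex_ex1I)
  obtain a where a: "a \<in> A" using assms(2) by blast
  define S where "S = (\<lambda>y. y - a) ` A"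
  have "subspace S"
    unfolding S_def using affine_diffs_subspace_subtract[OF assms(1) a] by simp
  then obtain y z where yz: "y \<in> S" "\<And>w. w \<in> S \<Longrightarrow> orthogonal z w" "x - a = y + z"
    using orthogonal_subspace_decomp_exists[of S "x - a"] by (metis span_eq_iff)
  have "a + y \<in> A" using yz(1) by (auto simp: S_def)
  moreover have "orthogonal (x - (a + y)) (w - (a + y))" if "w \<in> A" for w
  proof -
    have "w - a \<in> S" using that by (auto simp: S_def)
    then have "(w - a) - y \<in> S" using yz(1) \<open>subspace S\<close> subspace_diff by blast
    then have "orthogonal z ((w - a) - y)" by (rule yz(2))
    moreover have "x - (a + y) = z" using yz(3) by (simp add: algebra_simps)
    ultimately show ?thesis by (simp add: diff_diff_eq)
  qed
  ultimately show "\<exists>p. p \<in> A \<and> (\<forall>y\<in>A. orthogonal (x - p) (y - p))" by blast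
next
  fix p q
  assume "p \<in> A \<and> (\<forall>y\<in>A. orthogonal (x - p) (y - p))"
    and "q \<in> A \<and> (\<forall>y\<in>A. orthogonal (x - q) (y - q))"
  then have "(x - p) \<bullet> (q - p) = 0" "(x - q) \<bullet> (p - q) = 0"
    by (auto simp: orthogonal_def)
  then have "(p - q) \<bullet> (p - q) = 0"
    by (simp add: inner_diff_left inner_diff_right inner_commute)
  then show "p = q" by simp
qed

definition foundation_of :: "(real ^ 3) set \<Rightarrow> (real ^ 3) set \<Rightarrow> bool" where
  "foundation_of F P \<longleftrightarrow>
     F face_of P \<and> aff_dim F = 2 \<and> orthogonal_projection (affine hull F) ` P \<subseteq> F"

text \<open>The library's polyhedra, and faces of them, are convex; this covers tetrahedra.\<close>

definition height_function :: "(real ^ 3) set \<Rightarrow> bool" where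
  "height_function P \<longleftrightarrow> polyhedron P \<and> (\<exists>F. foundation_of F P)"

text \<open>
  The plane is \<open>{x. a \<bullet> x = b}\<close>. Replacing \<open>(a, b)\<close> by \<open>(-a, -b)\<close> exchanges its two closed
  half-spaces, so fixing the one that contains \<open>T0\<close> loses no generality.
\<close>

definition tetrahedral_subdivision ::
  "(real ^ 3) set \<Rightarrow> (real ^ 3) set \<Rightarrow> (real ^ 3) set \<Rightarrow> bool" where
  "tetrahedral_subdivision T T0 T1 \<longleftrightarrow>
     tetrahedron T0 \<and> tetrahedron T1 \<and> T0 \<noteq> T1 \<and> T = T0 \<union> T1 \<and>
     (\<exists>a b. a \<noteq> 0 \<and> T0 \<inter> T1 = T \<inter> {x. a \<bullet> x = b} \<and>
            T0 \<subseteq> {x. a \<bullet> x \<le> b} \<and> T1 \<subseteq> {x. a \<bullet> x \<ge> b})"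

end

theory Submission
  imports Defs
begin

text \<open>
  Let \<open>h i\<close> be the gradient of the barycentric coordinate of the vertex \<open>v i\<close>; it is an inner normal
  of the face opposite to \<open>v i\<close>, so the dihedral angle between the faces opposite to \<open>v i\<close> and
  \<open>v j\<close> is obtuse iff \<open>h i \<bullet> h j > 0\<close>, and a face without obtuse dihedral angles along its edges
  is a foundation. Because the gradients sum to zero and any three of them are independent, the
  graph of obtuse pairs has neither a vertex of degree 3 nor a 4-cycle. If no face is a foundation,
  the graph covers all four faces and so is a perfect matching or a path with three edges. In either
  case the obtuse angles include those at two opposite edges \<open>v i v j\<close> and \<open>v k v l\<close>, with at most
  one more, and cutting through \<open>v i v j\<close> orthogonally to the face \<open>v i v j v k\<close> gives two height
  functions.
\<close>

section \<open>Barycentric coordinates of a simplex\<close>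

text \<open>The affine functions \<open>h i \<bullet> x + c i\<close> are the barycentric
  coordinates for the vertices \<open>v i\<close>. Indexing by a type lets a moved vertex be written
  as a function update of \<open>v\<close>.\<close>

definition barycentric_frame ::
  "('n \<Rightarrow> 'a::euclidean_space) \<Rightarrow> ('n \<Rightarrow> 'a) \<Rightarrow> ('n \<Rightarrow> real) \<Rightarrow> bool" where
  "barycentric_frame v h c \<longleftrightarrow> (\<forall>i j. h i \<bullet> v j + c i = (if i = j then 1 else 0))"

lemma barycentric_frameD:
  assumes "barycentric_frame v h c"
  shows "h i \<bullet> v i + c i = 1" "i \<noteq> j \<Longrightarrow> h i \<bullet> v j + c i = 0"
  using assms by (auto simp: barycentric_frame_def)

lemma barycentric_frame_inj:
  assumes "barycentric_frame v h c"
  shows "inj v"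
proof (rule injI, rule ccontr)
  fix i j assume "v i = v j" "i \<noteq> j"
  then show False
    using barycentric_frameD[OF assms, of i] by (metis zero_neq_one)
qed

text \<open>The hyperplane on which coordinate \<open>i\<close> vanishes contains every vertex
  except \<open>v i\<close>.\<close>

lemma barycentric_frame_affine_independent:
  assumes "barycentric_frame v h c"
  shows "\<not> affine_dependent (range v)"
proof
  assume "affine_dependent (range v)"
  then obtain i where i: "v i \<in> affine hull (range v - {v i})"
    by (auto simp: affine_dependent_def)
  have "affine hull (range v - {v i}) \<subseteq> {x. h i \<bullet> x = - c i}"
  proof (rule hull_minimal)
    show "range v - {v i} \<subseteq> {x. h i \<bullet> x = - c i}"
    proof
      fix x assume "x \<in> range v - {v i}"
      then obtain j where "x = v j" "i \<noteq> j" by auto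
      then show "x \<in> {x. h i \<bullet> x = - c i}"
        using barycentric_frameD(2)[OF assms, of i j] by simp
    qed
    show "affine {x. h i \<bullet> x = - c i}" by (rule affine_hyperplane)
  qed
  then show False using i barycentric_frameD(1)[OF assms, of i] by auto
qed

text \<open>The number of vertices makes them span the whole space affinely, so \<open>x\<close> is
  an affine combination of them; evaluating coordinate \<open>i\<close> on that combination reads
  off its weight at \<open>v i\<close>.\<close>

lemma barycentric_frame_combination:
  fixes v :: "'n::finite \<Rightarrow> 'a::euclidean_space"
  assumes fr: "barycentric_frame v h c" and card: "CARD('n) = DIM('a) + 1"
  shows "(\<Sum>i\<in>UNIV. h i \<bullet> x + c i) = 1" "(\<Sum>i\<in>UNIV. (h i \<bullet> x + c i) *\<^sub>R v i) = x"
proof -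
  note inj = barycentric_frame_inj[OF fr]
  have "card (range v) = Suc DIM('a)"
    using card inj by (simp add: card_image)
  then have "affine hull (range v) = UNIV"
    using barycentric_frame_affine_independent[OF fr] affine_independent_span_eq by blast
  then have "x \<in> affine hull (range v)" by simp
  then obtain w where w: "sum w (range v) = 1" "(\<Sum>y\<in>range v. w y *\<^sub>R y) = x"
    unfolding affine_hull_finite[OF finite_imageI[OF finite_class.finite_UNIV]] by blast
  define u where "u = (\<lambda>i. w (v i))"
  have u: "sum u UNIV = 1" "(\<Sum>j\<in>UNIV. u j *\<^sub>R v j) = x"
    using w unfolding u_def by (simp_all add: sum.reindex[OF inj])
  have coord: "h i \<bullet> x + c i = u i" for i
  proof -
    have "h i \<bullet> x + c i = (\<Sum>j\<in>UNIV. u j * (h i \<bullet> v j)) + c i * sum u UNIV"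
      using u by (simp add: inner_sum_right flip: u(2))
    also have "\<dots> = (\<Sum>j\<in>UNIV. u j * (h i \<bullet> v j + c i))"
      by (simp add: sum_distrib_left sum.distrib algebra_simps)
    also have "\<dots> = (\<Sum>j\<in>UNIV. if i = j then u j else 0)"
      using fr by (intro sum.cong) (auto simp: barycentric_frame_def)
    finally show ?thesis by simp
  qed
  show "(\<Sum>i\<in>UNIV. h i \<bullet> x + c i) = 1" "(\<Sum>i\<in>UNIV. (h i \<bullet> x + c i) *\<^sub>R v i) = x"
    using u by (simp_all add: coord)
qed

text \<open>The coordinates add up to the constant 1, so the gradient of their sum vanishes.\<close>

lemma barycentric_frame_sum_eq_0:
  fixes v :: "'n::finite \<Rightarrow> 'a::euclidean_space"
  assumes fr: "barycentric_frame v h c" and card: "CARD('n) = DIM('a) + 1"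
  shows "(\<Sum>i\<in>UNIV. h i) = 0"
proof -
  have "(\<Sum>i\<in>UNIV. h i) \<bullet> x = 0" for x
    using barycentric_frame_combination(1)[OF assms, of x]
      barycentric_frame_combination(1)[OF assms, of 0]
    by (simp add: inner_sum_left sum.distrib)
  then show ?thesis using inner_eq_zero_iff by blast
qed

lemma barycentric_frame_convex_hull:
  fixes v :: "'n::finite \<Rightarrow> 'a::euclidean_space"
  assumes fr: "barycentric_frame v h c" and card: "CARD('n) = DIM('a) + 1"
  shows "convex hull (range v) = {x. \<forall>i. 0 \<le> h i \<bullet> x + c i}"
proof
  have "convex {x. \<forall>i. 0 \<le> h i \<bullet> x + c i}"
  proof -
    have "{x. \<forall>i. 0 \<le> h i \<bullet> x + c i} = (\<Inter>i. {x. h i \<bullet> x \<ge> - c i})"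
      by (auto simp: algebra_simps) (smt (verit))+
    then show ?thesis by (auto intro: convex_INT convex_halfspace_ge)
  qed
  then show "convex hull (range v) \<subseteq> {x. \<forall>i. 0 \<le> h i \<bullet> x + c i}"
    using fr by (intro hull_minimal) (auto simp: barycentric_frame_def)
  show "{x. \<forall>i. 0 \<le> h i \<bullet> x + c i} \<subseteq> convex hull (range v)"
  proof
    fix x assume x: "x \<in> {x. \<forall>i. 0 \<le> h i \<bullet> x + c i}"
    have "(\<Sum>i\<in>UNIV. (h i \<bullet> x + c i) *\<^sub>R v i) \<in> convex hull (range v)"
      using x barycentric_frame_combination(1)[OF assms, of x]
      by (intro convex_sum) (auto intro: hull_inc)
    then show "x \<in> convex hull (range v)"
      by (simp add: barycentric_frame_combination(2)[OF assms])
  qed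
qed

lemma barycentric_frame_tetrahedron:
  fixes v :: "4 \<Rightarrow> real ^ 3"
  assumes "barycentric_frame v h c"
  shows "tetrahedron (convex hull (range v))"
  unfolding tetrahedron_def simplex_def
  using barycentric_frame_affine_independent[OF assms] barycentric_frame_inj[OF assms]
  by (intro exI[of _ "range v"]) (simp add: card_image)

text \<open>Coordinate \<open>i\<close> is an equation of the plane through the other three
  vertices, rescaled to take the value 1 at \<open>v i\<close>.\<close>

lemma tetrahedron_barycentric_frame:
  assumes "tetrahedron T"
  obtains v :: "4 \<Rightarrow> real ^ 3" and h c
  where "barycentric_frame v h c" "T = convex hull (range v)"
proof -
  obtain C where C: "\<not> affine_dependent C" "int (card C) = 3 + 1" "T = convex hull C"
    using assms by (auto simp: tetrahedron_def simplex_def)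
  have fin: "finite C" using C(1) by (rule aff_independent_finite)
  have "card (UNIV :: 4 set) = card C" using C(2) by simp
  then obtain v :: "4 \<Rightarrow> real ^ 3" where v: "bij_betw v UNIV C"
    using finite_same_card_bij[OF finite_class.finite_UNIV fin] by blast
  have "\<exists>a b. \<forall>j. a \<bullet> v j + b = (if i = j then 1 else 0)" for i
  proof -
    have iC: "v i \<in> C" using v by (auto simp: bij_betw_def)
    let ?D = "C - {v i}"
    have ind: "\<not> affine_dependent ?D"
      using C(1) affine_independent_Diff by blast
    have "aff_dim ?D = 2"
      using aff_dim_affine_independent[OF ind] C(2) iC fin by simp
    then have "aff_dim ?D = DIM(real ^ 3) - 1" by simp
    then obtain a b where ab: "a \<noteq> 0" "affine hull ?D = {x. a \<bullet> x = b}"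
      using aff_dim_eq_hyperplane by blast
    have "v i \<notin> affine hull ?D" using C(1) iC by (auto simp: affine_dependent_def)
    then have ne: "a \<bullet> v i - b \<noteq> 0" using ab by simp
    have "a \<bullet> v j = b" if "j \<noteq> i" for j
    proof -
      have "v j \<in> ?D" using v that by (auto simp: bij_betw_def inj_def)
      then show ?thesis using ab(2) hull_inc[of "v j" ?D affine] by auto
    qed
    then have "\<forall>j. ((1 / (a \<bullet> v i - b)) *\<^sub>R a) \<bullet> v j + - b / (a \<bullet> v i - b)
      = (if i = j then 1 else 0)"
      using ne by (auto simp: divide_simps)
    then show ?thesis by blast
  qed
  then obtain h c where "\<forall>i j. h i \<bullet> v j + c i = (if i = j then 1 else 0)"
    by metis
  then have "barycentric_frame v h c" by (simp add: barycentric_frame_def)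
  moreover have "T = convex hull (range v)" using C(3) v by (simp add: bij_betw_def)
  ultimately show ?thesis by (rule that)
qed

section \<open>Foundations from nonobtuse dihedral angles\<close>

lemma orthogonal_projection_eqI:
  assumes "affine A" "p \<in> A" "\<And>y. y \<in> A \<Longrightarrow> orthogonal (x - p) (y - p)"
  shows "orthogonal_projection A x = p"
  unfolding orthogonal_projection_def
  using assms orthogonal_projection_ex1[of A x] by (intro the1_equality) auto

text \<open>Projecting a point of the tetrahedron onto the plane opposite to \<open>v i\<close>
  subtracts a nonnegative multiple of \<open>h i\<close>. By \<open>obt\<close> no other coordinate
  decreases, so the image stays in the tetrahedron and hence in the face.\<close>

lemma height_function_if_nonobtuse:
  fixes v :: "4 \<Rightarrow> real ^ 3"
  assumes fr: "barycentric_frame v h c" and obt: "\<And>j. j \<noteq> i \<Longrightarrow> h i \<bullet> h j \<le> 0"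
  shows "height_function (convex hull (range v))"
proof -
  let ?T = "convex hull (range v)"
  let ?P = "{x. h i \<bullet> x = - c i}"
  define F where "F = ?T \<inter> ?P"
  have T: "?T = {x. \<forall>i. 0 \<le> h i \<bullet> x + c i}"
    using fr by (rule barycentric_frame_convex_hull) simp
  have "h i \<noteq> 0"
  proof
    assume "h i = 0"
    moreover obtain j where "j \<noteq> i" by (metis zero_neq_one)
    ultimately show False using barycentric_frameD[OF fr, of i] by force
  qed
  then have pos: "h i \<bullet> h i > 0" by simp
  have FT: "F face_of ?T"
    unfolding F_def
  proof (rule face_of_Int_supporting_hyperplane_ge)
    fix x assume "x \<in> ?T"
    then have "0 \<le> h i \<bullet> x + c i" by (simp add: T)
    then show "- c i \<le> h i \<bullet> x" by linarith
  qed simp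
  have hullF: "affine hull F \<subseteq> ?P"
    by (rule hull_minimal) (auto simp: F_def affine_hyperplane)
  have "v ` (- {i}) \<subseteq> F"
  proof
    fix x assume "x \<in> v ` (- {i})"
    then obtain j where j: "x = v j" "i \<noteq> j" by auto
    then show "x \<in> F"
      using barycentric_frameD(2)[OF fr j(2)] by (auto simp: F_def intro: hull_inc)
  qed
  moreover have "aff_dim (v ` (- {i})) = 2"
  proof -
    have "\<not> affine_dependent (v ` (- {i}))"
      using barycentric_frame_affine_independent[OF fr] affine_dependent_subset by blast
    moreover have "card (v ` (- {i})) = 3"
      using barycentric_frame_inj[OF fr]
      by (simp add: card_image inj_on_subset Compl_eq_Diff_UNIV)
    ultimately show ?thesis using aff_dim_affine_independent[of "v ` (- {i})"] by simp
  qed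
  ultimately have "aff_dim F \<ge> 2" by (metis aff_dim_subset)
  moreover have "aff_dim F \<le> 2"
    using aff_dim_subset[of F ?P] aff_dim_hyperplane[OF \<open>h i \<noteq> 0\<close>] by (auto simp: F_def)
  moreover have "orthogonal_projection (affine hull F) x \<in> F" if x: "x \<in> ?T" for x
  proof -
    define t where "t = (h i \<bullet> x + c i) / (h i \<bullet> h i)"
    define p where "p = x - t *\<^sub>R h i"
    have t: "t \<ge> 0" using x pos by (simp add: T t_def)
    have pi: "h i \<bullet> p + c i = 0"
      using pos by (simp add: p_def t_def inner_diff_right)
    have "h j \<bullet> p + c j \<ge> 0" for j
    proof (cases "j = i")
      case False
      have "h j \<bullet> x + c j \<ge> 0" using x T by simp
      moreover have "t * (h j \<bullet> h i) \<le> 0"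
        using obt[OF False] t by (simp add: inner_commute mult_nonneg_nonpos)
      ultimately show ?thesis by (simp add: p_def inner_diff_right)
    qed (use pi in simp)
    then have pF: "p \<in> F" using pi by (simp add: F_def T)
    have "orthogonal_projection (affine hull F) x = p"
    proof (rule orthogonal_projection_eqI)
      show "p \<in> affine hull F" using pF by (rule hull_inc)
      fix y assume "y \<in> affine hull F"
      then have "h i \<bullet> y = - c i" using hullF by auto
      then have "h i \<bullet> (y - p) = 0" using pi unfolding inner_diff_right by linarith
      moreover have "x - p = t *\<^sub>R h i" by (simp add: p_def)
      ultimately show "orthogonal (x - p) (y - p)" by (simp add: orthogonal_def)
    qed simp
    then show ?thesis using pF by simp
  qed
  ultimately have "foundation_of F ?T"
    using FT by (auto simp: foundation_of_def)
  moreover have "polyhedron ?T" by (simp add: polyhedron_convex_hull)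
  ultimately show ?thesis by (auto simp: height_function_def)
qed

section \<open>Cutting a tetrahedron through an edge\<close>

text \<open>
  Moving \<open>v l\<close> to a point of the edge \<open>v k v l\<close> changes only the two barycentric coordinates of that
  edge.
\<close>

lemma barycentric_frame_cut:
  fixes s :: real
  assumes fr: "barycentric_frame v h c" and kl: "k \<noteq> l" and s: "s \<noteq> 0"
  shows "barycentric_frame (v(l := (1 - s) *\<^sub>R v k + s *\<^sub>R v l))
    (h(k := h k - ((1 - s) / s) *\<^sub>R h l, l := (1 / s) *\<^sub>R h l))
    (c(k := c k - ((1 - s) / s) * c l, l := (1 / s) * c l))"
  unfolding barycentric_frame_def
proof (intro allI)
  fix i j
  have d: "h i \<bullet> v i = 1 - c i" "i \<noteq> j \<Longrightarrow> h i \<bullet> v j = - c i" for i j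
    using barycentric_frameD[OF fr, of i] by (simp, metis add_eq_0_iff2)
  show "(h(k := h k - ((1 - s) / s) *\<^sub>R h l, l := (1 / s) *\<^sub>R h l)) i
      \<bullet> (v(l := (1 - s) *\<^sub>R v k + s *\<^sub>R v l)) j
      + (c(k := c k - ((1 - s) / s) * c l, l := (1 / s) * c l)) i = (if i = j then 1 else 0)"
  proof (cases "j = l")
    case True
    then show ?thesis
      using kl s by (auto simp: d inner_diff_left inner_add_right) (simp_all add: field_simps)
  next
    case False
    then show ?thesis
      using kl s by (cases "j = k") (auto simp: d inner_diff_left)
  qed
qed

text \<open>In the frame of the cut simplex, coordinate \<open>l\<close> is only rescaled by a
  positive factor and keeps its half-space, while coordinate \<open>k\<close> now bounds the
  half-space of the cut.\<close>

lemma convex_hull_cut: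
  fixes v :: "'n::finite \<Rightarrow> 'a::euclidean_space"
  assumes fr: "barycentric_frame v h c" and card: "CARD('n) = DIM('a) + 1"
    and kl: "k \<noteq> l" and s: "0 < s"
  shows "convex hull (range (v(l := (1 - s) *\<^sub>R v k + s *\<^sub>R v l))) =
    {x. (\<forall>i. i \<noteq> k \<longrightarrow> 0 \<le> h i \<bullet> x + c i) \<and>
        (1 - s) * (h l \<bullet> x + c l) \<le> s * (h k \<bullet> x + c k)}"
proof -
  have l: "0 \<le> ((1 / s) *\<^sub>R h l) \<bullet> x + (1 / s) * c l \<longleftrightarrow> 0 \<le> h l \<bullet> x + c l" for x
  proof -
    have "((1 / s) *\<^sub>R h l) \<bullet> x + (1 / s) * c l = (h l \<bullet> x + c l) / s"
      using s by (simp add: field_simps)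
    then show ?thesis using s by (simp only: zero_le_divide_iff) auto
  qed
  have k: "0 \<le> (h k - ((1 - s) / s) *\<^sub>R h l) \<bullet> x + (c k - ((1 - s) / s) * c l)
      \<longleftrightarrow> (1 - s) * (h l \<bullet> x + c l) \<le> s * (h k \<bullet> x + c k)" for x
  proof -
    have "(h k - ((1 - s) / s) *\<^sub>R h l) \<bullet> x + (c k - ((1 - s) / s) * c l)
        = (s * (h k \<bullet> x + c k) - (1 - s) * (h l \<bullet> x + c l)) / s"
      using s by (simp add: field_simps inner_diff_left)
    then show ?thesis using s by (simp only: zero_le_divide_iff) auto
  qed
  let ?h = "h(k := h k - ((1 - s) / s) *\<^sub>R h l, l := (1 / s) *\<^sub>R h l)"
  let ?c = "c(k := c k - ((1 - s) / s) * c l, l := (1 / s) * c l)"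
  have "(\<forall>i. 0 \<le> ?h i \<bullet> x + ?c i) \<longleftrightarrow>
      (\<forall>i. i \<noteq> k \<longrightarrow> 0 \<le> h i \<bullet> x + c i) \<and>
      (1 - s) * (h l \<bullet> x + c l) \<le> s * (h k \<bullet> x + c k)" for x
  proof -
    have split: "(\<forall>i. Q i) \<longleftrightarrow> (\<forall>i. i \<noteq> k \<longrightarrow> i \<noteq> l \<longrightarrow> Q i) \<and> Q k \<and> Q l" for Q
      by metis
    have "(\<forall>i. 0 \<le> ?h i \<bullet> x + ?c i) \<longleftrightarrow>
        (\<forall>i. i \<noteq> k \<longrightarrow> i \<noteq> l \<longrightarrow> 0 \<le> ?h i \<bullet> x + ?c i)
        \<and> 0 \<le> ?h k \<bullet> x + ?c k \<and> 0 \<le> ?h l \<bullet> x + ?c l"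
      by (rule split)
    also have "\<dots> \<longleftrightarrow> (\<forall>i. i \<noteq> k \<longrightarrow> i \<noteq> l \<longrightarrow> 0 \<le> h i \<bullet> x + c i)
        \<and> (1 - s) * (h l \<bullet> x + c l) \<le> s * (h k \<bullet> x + c k) \<and> 0 \<le> h l \<bullet> x + c l"
      using k[of x] l[of x] kl by simp
    finally show ?thesis using kl by metis
  qed
  then show ?thesis
    using barycentric_frame_convex_hull[OF barycentric_frame_cut[OF fr kl] card] s by simp
qed

text \<open>The two pieces are symmetric: exchanging \<open>k\<close> with \<open>l\<close> and
  \<open>s\<close> with \<open>1 - s\<close> turns one into the other, so
  \<open>convex_hull_cut\<close> describes both.\<close>

lemma tetrahedral_subdivision_cut:
  fixes v :: "4 \<Rightarrow> real ^ 3"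
  assumes fr: "barycentric_frame v h c" and kl: "k \<noteq> l" and s: "0 < s" "s < 1"
    and E: "E = (1 - s) *\<^sub>R v k + s *\<^sub>R v l"
  shows "tetrahedral_subdivision (convex hull (range v))
    (convex hull (range (v(l := E)))) (convex hull (range (v(k := E))))"
proof -
  have E': "E = (1 - (1 - s)) *\<^sub>R v l + (1 - s) *\<^sub>R v k" by (simp add: E add.commute)
  let ?lam = "\<lambda>i x. h i \<bullet> x + c i"
  let ?T = "convex hull (range v)"
  let ?L = "convex hull (range (v(l := E)))"
  let ?R = "convex hull (range (v(k := E)))"
  \<comment> \<open>The plane \<open>?a \<bullet> x = ?b\<close> passes through \<open>E\<close> and
    the two vertices other than \<open>v k\<close> and \<open>v l\<close>: the weighted coordinate
    difference in \<open>side\<close> vanishes at all three.\<close>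
  let ?a = "(1 - s) *\<^sub>R h l - s *\<^sub>R h k" and ?b = "s * c k - (1 - s) * c l"
  have T: "?T = {x. \<forall>i. 0 \<le> ?lam i x}"
    using fr by (rule barycentric_frame_convex_hull) simp
  have T0: "?L = {x. (\<forall>i. i \<noteq> k \<longrightarrow> 0 \<le> ?lam i x) \<and> (1 - s) * ?lam l x \<le> s * ?lam k x}"
    unfolding E using s by (intro convex_hull_cut[OF fr _ kl]) auto
  have "?R = {x. (\<forall>i. i \<noteq> l \<longrightarrow> 0 \<le> ?lam i x) \<and>
      (1 - (1 - s)) * ?lam k x \<le> (1 - s) * ?lam l x}"
    unfolding E' using s kl by (intro convex_hull_cut[OF fr]) auto
  then have T1: "?R = {x. (\<forall>i. i \<noteq> l \<longrightarrow> 0 \<le> ?lam i x) \<and> s * ?lam k x \<le> (1 - s) * ?lam l x}"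
    by simp
  have side: "?a \<bullet> x - ?b = (1 - s) * ?lam l x - s * ?lam k x" for x
    by (simp add: inner_diff_left algebra_simps)
  have T0': "?L = ?T \<inter> {x. ?a \<bullet> x \<le> ?b}"
  proof -
    \<comment> \<open>The inequality for \<open>k\<close>, absent from the description of
      \<open>?L\<close>, follows from the one for \<open>l\<close> and the cut.\<close>
    have "0 \<le> ?lam k x"
      if "0 \<le> ?lam l x" "(1 - s) * ?lam l x \<le> s * ?lam k x" for x
      using that s by (smt (verit) mult_nonneg_nonneg zero_le_mult_iff)
    moreover have "(?a \<bullet> x \<le> ?b) = ((1 - s) * ?lam l x \<le> s * ?lam k x)" for x
      using side[of x] by linarith
    ultimately show ?thesis unfolding T T0 using kl by (auto, metis)
  qed
  have T1': "?R = ?T \<inter> {x. ?a \<bullet> x \<ge> ?b}"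
  proof -
    have "0 \<le> ?lam l x"
      if "0 \<le> ?lam k x" "s * ?lam k x \<le> (1 - s) * ?lam l x" for x
      using that s by (smt (verit) mult_nonneg_nonneg zero_le_mult_iff)
    moreover have "(?a \<bullet> x \<ge> ?b) = (s * ?lam k x \<le> (1 - s) * ?lam l x)" for x
      using side[of x] by linarith
    ultimately show ?thesis unfolding T T1 using kl by (auto, metis)
  qed
  have "?a \<bullet> v k - ?b = - s"
    unfolding side using barycentric_frameD[OF fr] kl by simp
  moreover have "?a \<bullet> v l - ?b = 1 - s"
    unfolding side using barycentric_frameD[OF fr] kl by simp
  ultimately have a: "?a \<bullet> v k < ?b" "?b < ?a \<bullet> v l" using s by auto
  have "v k \<in> ?T" by (simp add: hull_inc)
  then have "v k \<in> ?L" "v k \<notin> ?R" unfolding T0' T1' using a by auto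
  then have "?L \<noteq> ?R" by blast
  moreover have "?a \<noteq> 0" using a by auto
  moreover have "tetrahedron ?L"
    unfolding E using s
    by (intro barycentric_frame_tetrahedron[OF barycentric_frame_cut[OF fr kl]]) simp
  moreover have "tetrahedron ?R"
    unfolding E' using s
    by (intro barycentric_frame_tetrahedron[OF barycentric_frame_cut[OF fr kl[symmetric]]]) simp
  moreover have "?T = ?L \<union> ?R" unfolding T0' T1' by auto
  moreover have "?L \<inter> ?R = ?T \<inter> {x. ?a \<bullet> x = ?b}" unfolding T0' T1' by auto
  ultimately show ?thesis
    unfolding tetrahedral_subdivision_def using T0' T1' by blast
qed

section \<open>Graphs on four vertices\<close>

lemma obtain_complement_4:
  fixes i j :: 4
  assumes "i \<noteq> j"
  obtains k l where "distinct [i, j, k, l]"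
proof -
  have "card (UNIV - {i, j}) = 2" using assms by (simp add: card_Diff_subset)
  then obtain k l where "UNIV - {i, j} = {k, l}" "k \<noteq> l" by (auto simp: card_2_iff)
  then have "distinct [i, j, k, l]" using assms by auto
  then show ?thesis by (rule that)
qed

lemma UNIV_4_distinct:
  fixes i j k l :: 4
  assumes "distinct [i, j, k, l]"
  shows "UNIV = {i, j, k, l}"
proof -
  have "card {i, j, k, l} = CARD(4)" using assms by simp
  then show ?thesis by (metis card_subset_eq finite_class.finite_UNIV subset_UNIV)
qed

lemma sum_4_distinct:
  fixes i j k l :: 4
  assumes "distinct [i, j, k, l]"
  shows "sum f UNIV = f i + f j + f k + f l"
  unfolding UNIV_4_distinct[OF assms] using assms by (simp add: ac_simps)

text \<open>Read \<open>P\<close> as adjacency. Given an edge \<open>i j\<close>, either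
  \<open>k l\<close> is an edge too, or \<open>k\<close> and \<open>l\<close> have neighbours among
  \<open>i\<close> and \<open>j\<close>; these differ, as no vertex has degree 3, and so give a
  perfect matching. Two further edges besides a matching would create a vertex of degree 3 or a
  4-cycle.\<close>

lemma obtain_opposite_obtuse:
  fixes P :: "4 \<Rightarrow> 4 \<Rightarrow> bool"
  assumes sym: "\<And>i j. P i j \<Longrightarrow> P j i" and cover: "\<And>i. \<exists>j. j \<noteq> i \<and> P i j"
    and star: "\<And>i j k l. distinct [i, j, k, l] \<Longrightarrow> \<not> (P i j \<and> P i k \<and> P i l)"
    and cut: "\<And>i j k l. distinct [i, j, k, l] \<Longrightarrow> \<not> (P i k \<and> P i l \<and> P j k \<and> P j l)"
  obtains i j k l where "distinct [i, j, k, l]" "P i j" "P k l" "\<not> P i k" "\<not> P i l" "\<not> P j k"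
proof -
  have "\<exists>i j k l. distinct [i, j, k, l] \<and> P i j \<and> P k l"
  proof -
    obtain i j where ij: "i \<noteq> j" "P i j" using cover by metis
    then obtain k l where d: "distinct [i, j, k, l]" using obtain_complement_4 by blast
    note U = UNIV_4_distinct[OF d]
    obtain k' where k': "k' \<noteq> k" "P k k'" using cover by blast
    obtain l' where l': "l' \<noteq> l" "P l l'" using cover by blast
    have "k' \<in> {i, j, k, l}" "l' \<in> {i, j, k, l}" using U by auto
    then have "P k l \<or> (P i k \<and> P i l) \<or> (P j k \<and> P j l) \<or> (P i k \<and> P j l) \<or> (P j k \<and> P i l)"
      using k' l' sym by auto
    moreover have "\<not> (P i k \<and> P i l)" using star[OF d] ij by blast
    moreover have "\<not> (P j k \<and> P j l)" using star[of j i k l] d ij sym by auto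
    moreover have "distinct [i, k, j, l]" "distinct [j, k, i, l]" using d by auto
    ultimately show ?thesis using d ij by blast
  qed
  then obtain i j k l where d: "distinct [i, j, k, l]" and p: "P i j" "P k l" by blast
  have s: "\<not> (P i k \<and> P i l)" "\<not> (P j k \<and> P j l)" "\<not> (P i k \<and> P j k)" "\<not> (P i l \<and> P j l)"
    using star[of i j k l] star[of j i k l] star[of k l i j] star[of l k i j] d p sym by auto
  have c: "\<not> (P i k \<and> P j l)" "\<not> (P i l \<and> P j k)"
    using cut[of i l j k] cut[of i k j l] d p sym by auto
  \<comment> \<open>At most one edge joins the two matched pairs; relabelling makes it
    \<open>j l\<close>, the only pair left open in the conclusion.\<close>
  consider "\<not> P i k \<and> \<not> P i l \<and> \<not> P j k" | "P i k" | "P i l" | "P j k" by blast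
  then show ?thesis
  proof cases
    case 1
    then show ?thesis using that[of i j k l] d p by blast
  next
    case 2
    then show ?thesis using that[of j i l k] d p s c sym by auto
  next
    case 3
    then show ?thesis using that[of j i k l] d p s c sym by auto
  next
    case 4
    then show ?thesis using that[of i j l k] d p s c sym by auto
  qed
qed

section \<open>Gram matrix of the gradients and choice of the cut\<close>

theorem theorem5p1:
  fixes T :: "(real ^ 3) set"
  assumes "tetrahedron T"
  shows "height_function T \<or>
    (\<exists>T0 T1. tetrahedral_subdivision T T0 T1 \<and> height_function T0 \<and> height_function T1)"
proof (cases "height_function T")
  case False
  obtain v :: "4 \<Rightarrow> real ^ 3" and h c
    where fr: "barycentric_frame v h c" and T: "T = convex hull (range v)"
    using tetrahedron_barycentric_frame[OF assms] by blast
  \<comment> \<open>\<open>g\<close> is the Gram matrix of the gradients. Its rows sum to zero, and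
    its positive off-diagonal entries are the obtuse pairs.\<close>
  define g where "g = (\<lambda>i j. h i \<bullet> h j)"
  have sym: "g i j = g j i" for i j by (simp add: g_def inner_commute)
  have hsum: "h i + h j + h k + h l = 0" if "distinct [i, j, k, l]" for i j k l
    using barycentric_frame_sum_eq_0[OF fr] sum_4_distinct[OF that, of h] by simp
  have row: "g m i + g m j + g m k + g m l = 0" if "distinct [i, j, k, l]" for i j k l m
    using arg_cong[OF hsum[OF that], of "\<lambda>x. h m \<bullet> x"] by (simp add: g_def inner_add_right)
  have pos: "g i i > 0" for i
  proof -
    obtain j where "j \<noteq> i" by (metis zero_neq_one)
    then have "h i \<noteq> 0" using barycentric_frameD[OF fr, of i] by force
    then show ?thesis by (simp add: g_def)
  qed
  have pair: "g i i + 2 * g i j + g j j > 0" if d: "distinct [i, j, k, l]" for i j k l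
  proof -
    have "(h i + h j) \<bullet> (v i - v k) = 1"
      using barycentric_frameD(1)[OF fr, of i] barycentric_frameD(2)[OF fr, of i k]
        barycentric_frameD(2)[OF fr, of j k] barycentric_frameD(2)[OF fr, of j i] d
      unfolding inner_add_left inner_diff_right by auto
    then have "h i + h j \<noteq> 0" by auto
    then have "(h i + h j) \<bullet> (h i + h j) > 0" by simp
    then show ?thesis by (simp add: g_def inner_add_left inner_add_right inner_commute)
  qed
  have cover: "\<exists>j. j \<noteq> i \<and> g i j > 0" for i
    using height_function_if_nonobtuse[OF fr, of i] False T by (force simp: g_def)
  \<comment> \<open>Row \<open>i\<close> sums to zero, but its diagonal entry is positive.\<close>
  have star: "\<not> (g i j > 0 \<and> g i k > 0 \<and> g i l > 0)" if "distinct [i, j, k, l]" for i j k l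
    using row[OF that, of i] pos[of i] by linarith
  \<comment> \<open>Rows \<open>i\<close> and \<open>j\<close> together sum to zero; by
    \<open>pair\<close> the entries with both indices in \<open>i\<close>, \<open>j\<close>
    contribute a positive amount, so the four others cannot all be positive.\<close>
  have cut: "\<not> (g i k > 0 \<and> g i l > 0 \<and> g j k > 0 \<and> g j l > 0)"
    if "distinct [i, j, k, l]" for i j k l
    using row[OF that, of i] row[OF that, of j] pair[OF that] sym[of i j] by linarith
  obtain i j k l where d: "distinct [i, j, k, l]" and ij: "g i j > 0" and kl: "g k l > 0"
    and neg: "g i k \<le> 0" "g i l \<le> 0" "g j k \<le> 0"
  proof (rule obtain_opposite_obtuse[of "\<lambda>i j. g i j > 0"])
    show "g j i > 0" if "g i j > 0" for i j using that sym by simp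
  qed (use cover star cut in \<open>auto simp: not_less\<close>)
  \<comment> \<open>With this \<open>s\<close> the plane through \<open>v i\<close>, \<open>v j\<close>, \<open>E\<close> is orthogonal to the face opposite to \<open>v l\<close>;
    see \<open>orth\<close> below.\<close>
  define s where "s = g l l / (g k l + g l l)"
  have s: "0 < s" "s < 1" using pos[of l] kl by (simp_all add: s_def)
  have "1 - s = g k l / (g k l + g l l)"
    using pos[of l] kl by (simp add: s_def field_simps)
  then have "(1 - s) / s = g k l / g l l" "s / (1 - s) = g l l / g k l"
    using pos[of l] kl by (simp_all add: s_def)
  then have r: "(1 - s) / s = g k l / g l l" "(1 - (1 - s)) / (1 - s) = g l l / g k l"
    by simp_all
  define E where "E = (1 - s) *\<^sub>R v k + s *\<^sub>R v l"
  have cs: "(g p q)\<^sup>2 \<le> g p p * g q q" for p q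
    using Cauchy_Schwarz_ineq by (simp add: g_def)
  have U: "m = i \<or> m = j \<or> m = k \<or> m = l" for m
    using UNIV_I[of m] unfolding UNIV_4_distinct[OF d] by simp
  have kl': "k \<noteq> l" "l \<noteq> k" using d by auto
  have "tetrahedral_subdivision T (convex hull (range (v(l := E)))) (convex hull (range (v(k := E))))"
    unfolding T using fr kl'(1) s E_def by (rule tetrahedral_subdivision_cut)
  \<comment> \<open>The foundation is the face \<open>v i v j v l\<close>. The cut takes a right
    angle off the obtuse dihedral angle at the edge \<open>v i v j\<close>, and the remainder is not
    obtuse; algebraically this is Cauchy-Schwarz for \<open>h k\<close> and
    \<open>h l\<close>.\<close>
  moreover have "height_function (convex hull (range (v(k := E))))"
  proof -
    have E': "E = (1 - (1 - s)) *\<^sub>R v l + (1 - s) *\<^sub>R v k"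
      by (simp add: E_def add.commute)
    have "g k l * g k l \<le> g l l * g k k"
      using cs[of k l] by (simp add: power2_eq_square mult.commute)
    then have "g k l \<le> g l l / g k l * g k k"
      using kl by (simp add: field_simps)
    then have "h k \<bullet> (h l - ((1 - (1 - s)) / (1 - s)) *\<^sub>R h k) \<le> 0"
      unfolding r by (simp add: inner_diff_right g_def)
    moreover have "h k \<bullet> h m \<le> 0" if "m \<noteq> k" "m \<noteq> l" for m
      using U[of m] that neg by (auto simp: g_def inner_commute)
    ultimately show ?thesis
      unfolding E' using s kl'(2)
      by (intro height_function_if_nonobtuse[OF barycentric_frame_cut[OF fr], where i = k])
        (auto simp: divide_le_0_iff)
  qed
  moreover have "height_function (convex hull (range (v(l := E))))"
  proof -
    have fr': "barycentric_frame (v(l := E))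
        (h(k := h k - ((1 - s) / s) *\<^sub>R h l, l := (1 / s) *\<^sub>R h l))
        (c(k := c k - ((1 - s) / s) * c l, l := (1 / s) * c l))"
      unfolding E_def using fr kl' s by (intro barycentric_frame_cut) auto
    have orth: "(h k - ((1 - s) / s) *\<^sub>R h l) \<bullet> h l = 0"
      using pos[of l] unfolding r by (simp add: inner_diff_left g_def)
    show ?thesis
    \<comment> \<open>If \<open>g j l\<close> is not positive, the face \<open>v i v j v k\<close>
      is a foundation of this piece. Otherwise the cutting face \<open>v i v j E\<close> is one. In
      both cases \<open>orth\<close> handles the right angle between these two faces.\<close>
    proof (cases "g j l \<le> 0")
      case True
      have "h l \<bullet> h m \<le> 0" if "m \<noteq> k" "m \<noteq> l" for m
        using U[of m] that neg True by (auto simp: g_def inner_commute)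
      then show ?thesis
        using s kl' orth
        by (intro height_function_if_nonobtuse[OF fr', where i = l])
          (auto simp: divide_le_0_iff inner_commute)
    next
      case False
      \<comment> \<open>Eliminating \<open>g i k\<close> and \<open>g k l\<close> by the row sums
        leaves terms of known sign: the first bracket is nonpositive by Cauchy-Schwarz, the second
        because \<open>g i l \<le> 0\<close> while \<open>g j l\<close> and \<open>g i j\<close> are
        positive.\<close>
      have "g i k = - (g i i + g i j + g i l)" "g k l = - (g l l + g i l + g j l)"
        using row[OF d, of i] row[OF d, of l] sym[of l i] sym[of l j] sym[of l k] by linarith+
      \<comment> \<open>The left-hand side is at most 0 iff the angle at \<open>v j\<close> in the triangle \<open>v i v j v k\<close> is not
        obtuse, that is, iff \<open>v k\<close> projects to the correct side of \<open>v j\<close> on the edge \<open>v i v j\<close>.\<close>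
      then have "g i k * g l l - g i l * g k l =
          ((g i l)\<^sup>2 - g i i * g l l) + (g i l * g j l - g i j * g l l)"
        by algebra
      moreover have "g i l * g j l \<le> 0" "0 \<le> g i j * g l l"
        using neg False ij pos[of l] by (auto simp: mult_nonpos_nonneg)
      ultimately have "g i k * g l l \<le> g i l * g k l" using cs[of i l] by linarith
      then have "g k i \<le> g k l / g l l * g l i"
        using pos[of l] sym[of k i] sym[of l i] by (simp add: field_simps)
      then have ki: "(h k - ((1 - s) / s) *\<^sub>R h l) \<bullet> h i \<le> 0"
        unfolding r by (simp add: inner_diff_left g_def)
      have "0 \<le> g k l / g l l * g l j"
        using kl pos[of l] False sym[of l j] by simp
      then have kj: "(h k - ((1 - s) / s) *\<^sub>R h l) \<bullet> h j \<le> 0"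
        using neg(3) sym[of j k] unfolding r by (simp add: inner_diff_left g_def)
      have "(h k - ((1 - s) / s) *\<^sub>R h l) \<bullet> h m \<le> 0" if "m \<noteq> k" "m \<noteq> l" for m
        using U[of m] that ki kj by auto
      then show ?thesis
        using kl' orth by (intro height_function_if_nonobtuse[OF fr', where i = k]) auto
    qed
  qed
  ultimately show ?thesis by blast
qed simp

end
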